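(* Let $A$ be a weakly amenable Banach algebra with property $\mathbb{B}$ and having a bounded approximate identity. If a continuous bilinear functional $\varphi\colon A\times A\to\mathbb{C}$ satisfies $$a,b\in A,\ ab=ba=0\ \Longrightarrow\ \varphi(a,b)=0,$$ then there exist $\tau_1,\tau_2\in A^*$ such that $$\varphi(a,b)=\tau_1(ab)+\tau_2(ba)\quad\text{for all } a,b\in A.$$
   Context: Banach algebras are complex; $A^*$ is the dual space of $A$, which is a Banach $A$-bimodule via $(a\cdot f)(c)=f(ca)$, $(f\cdot a)(c)=f(ac)$ for $a,c\in A$, $f\in A^*$. A derivation $\delta\colon A\to A^*$ is a linear map with $\delta(ab)=\delta(a)\cdot b+a\cdot\delta(b)$ for all $a,b\in A$; it is inner if there is $\omega\in A^*$ with $\delta(a)=a\cdot\omega-\omega\cdot a$ for all $a\in A$. $A$ is weakly amenable if every continuous derivation from $A$ into $A^*$ is inner. $A$ has property $\mathbb{B}$ if every continuous bilinear functional $\varphi\colon A\times A\to\mathbb{C}$ such that $ab=0$ implies $\varphi(a,b)=0$ (for $a,b\in A$) satisfies $\varphi(ab,c)=\varphi(a,bc)$ for all $a,b,c\in A$. Approximate identities are two-sided. *)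

theory Defs
  imports "HOL-Analysis.Analysis"
begin

section \<open>Complex Banach algebras\<close>

text \<open>
  The libraries only provide real scalar multiplication on normed spaces. A complex structure is
  added on top of it; \<open>scaleR_conv_scaleC\<close> makes it extend the given real structure.
\<close>

class complex_normed_vector = real_normed_vector +
  fixes scaleC :: "complex \<Rightarrow> 'a \<Rightarrow> 'a"  (infixr \<open>*\<^sub>C\<close> 75)
  assumes scaleC_add_right: "c *\<^sub>C (x + y) = c *\<^sub>C x + c *\<^sub>C y"
    and scaleC_add_left: "(c + d) *\<^sub>C x = c *\<^sub>C x + d *\<^sub>C x"
    and scaleC_scaleC: "c *\<^sub>C d *\<^sub>C x = (c * d) *\<^sub>C x"
    and scaleR_conv_scaleC: "r *\<^sub>R x = complex_of_real r *\<^sub>C x"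
    and norm_scaleC: "norm (c *\<^sub>C x) = cmod c * norm x"

text \<open>Algebras are not assumed to be unital.\<close>

class complex_normed_algebra = complex_normed_vector + real_normed_algebra +
  assumes mult_scaleC_left: "(c *\<^sub>C x) * y = c *\<^sub>C (x * y)"
    and mult_scaleC_right: "x * (c *\<^sub>C y) = c *\<^sub>C (x * y)"

class complex_banach_algebra = complex_normed_algebra + complete_space

instantiation complex :: complex_banach_algebra
begin

definition scaleC_complex :: "complex \<Rightarrow> complex \<Rightarrow> complex" where
  "scaleC_complex c z = c * z"

instance
  by standard (auto simp: scaleC_complex_def algebra_simps norm_mult scaleR_conv_of_real)

end

definition clinear :: "('a::complex_normed_vector \<Rightarrow> 'b::complex_normed_vector) \<Rightarrow> bool" where
  "clinear f \<longleftrightarrow> (\<forall>x y. f (x + y) = f x + f y) \<and> (\<forall>c x. f (c *\<^sub>C x) = c *\<^sub>C f x)"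


section \<open>The dual bimodule\<close>

instantiation blinfun :: (real_normed_vector, complex_normed_vector) complex_normed_vector
begin

lift_definition scaleC_blinfun :: "complex \<Rightarrow> ('a \<Rightarrow>\<^sub>L 'b) \<Rightarrow> ('a \<Rightarrow>\<^sub>L 'b)" is "\<lambda>c f x. c *\<^sub>C f x"
proof -
  fix c :: complex and f :: "'a \<Rightarrow> 'b"
  assume f: "bounded_linear f"
  have "bounded_linear (\<lambda>x::'b. c *\<^sub>C x)"
    by (rule bounded_linear_intro[where K = "cmod c"])
      (simp_all add: scaleC_add_right norm_scaleC scaleR_conv_scaleC scaleC_scaleC mult.commute)
  from bounded_linear_compose[OF this f] show "bounded_linear (\<lambda>x. c *\<^sub>C f x)" .
qed

instance
proof
  fix c d :: complex and r :: real and f g :: "'a \<Rightarrow>\<^sub>L 'b"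
  show "c *\<^sub>C (f + g) = c *\<^sub>C f + c *\<^sub>C g"
    by transfer (simp add: scaleC_add_right)
  show "(c + d) *\<^sub>C f = c *\<^sub>C f + d *\<^sub>C f"
    by transfer (simp add: scaleC_add_left)
  show "c *\<^sub>C d *\<^sub>C f = (c * d) *\<^sub>C f"
    by transfer (simp add: scaleC_scaleC)
  show "r *\<^sub>R f = complex_of_real r *\<^sub>C f"
    by transfer (simp add: scaleR_conv_scaleC)
  show "norm (c *\<^sub>C f) = cmod c * norm f"
  proof transfer
    fix c :: complex and f :: "'a \<Rightarrow> 'b"
    assume f: "bounded_linear f"
    have "onorm (\<lambda>x. c *\<^sub>C f x) = onorm (\<lambda>x. cmod c *\<^sub>R f x)"
      by (simp add: onorm_def norm_scaleC)
    then show "onorm (\<lambda>x. c *\<^sub>C f x) = cmod c * onorm f"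
      using onorm_scaleR[OF f, of "cmod c"] by simp
  qed
qed

end

text \<open>
  The dual space \<open>A\<^sup>*\<close> is a complex subspace of the space of bounded real-linear maps into the complex
  numbers, from which it takes its norm and its vector space operations.
\<close>

definition dual :: "('a::complex_normed_vector \<Rightarrow>\<^sub>L complex) set" where
  "dual = {f. clinear (blinfun_apply f)}"

text \<open>The actions are \<open>(a \<cdot> f)(c) = f(ca)\<close> and \<open>(f \<cdot> a)(c) = f(ac)\<close>.\<close>

definition act_left :: "'a::complex_normed_algebra \<Rightarrow> ('a \<Rightarrow>\<^sub>L complex) \<Rightarrow> ('a \<Rightarrow>\<^sub>L complex)" where
  "act_left a f = f o\<^sub>L blinfun_mult_left a"

definition act_right :: "('a::complex_normed_algebra \<Rightarrow>\<^sub>L complex) \<Rightarrow> 'a \<Rightarrow> ('a \<Rightarrow>\<^sub>L complex)" where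
  "act_right f a = f o\<^sub>L blinfun_mult_right a"

lemma act_left_apply [simp]: "blinfun_apply (act_left a f) c = blinfun_apply f (c * a)"
  by (simp add: act_left_def)

lemma act_right_apply [simp]: "blinfun_apply (act_right f a) c = blinfun_apply f (a * c)"
  by (simp add: act_right_def)

lemma act_left_in_dual: "f \<in> dual \<Longrightarrow> act_left a f \<in> dual"
  by (simp add: dual_def clinear_def distrib_right mult_scaleC_left)

lemma act_right_in_dual: "f \<in> dual \<Longrightarrow> act_right f a \<in> dual"
  by (simp add: dual_def clinear_def distrib_left mult_scaleC_right)


section \<open>Weak amenability\<close>

definition derivation :: "('a::complex_normed_algebra \<Rightarrow> ('a \<Rightarrow>\<^sub>L complex)) \<Rightarrow> bool" where
  "derivation \<delta> \<longleftrightarrow> (\<forall>a. \<delta> a \<in> dual) \<and> clinear \<delta> \<and>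
     (\<forall>a b. \<delta> (a * b) = act_right (\<delta> a) b + act_left a (\<delta> b))"

definition inner_derivation :: "('a::complex_normed_algebra \<Rightarrow> ('a \<Rightarrow>\<^sub>L complex)) \<Rightarrow> bool" where
  "inner_derivation \<delta> \<longleftrightarrow> (\<exists>\<omega>\<in>dual. \<forall>a. \<delta> a = act_left a \<omega> - act_right \<omega> a)"

definition weakly_amenable :: "'a::complex_banach_algebra itself \<Rightarrow> bool" where
  "weakly_amenable _ \<longleftrightarrow>
     (\<forall>\<delta> :: 'a \<Rightarrow> ('a \<Rightarrow>\<^sub>L complex).
        derivation \<delta> \<and> continuous_on UNIV \<delta> \<longrightarrow> inner_derivation \<delta>)"


section \<open>Property B\<close>

definition continuous_bilinear :: "('a::complex_normed_vector \<Rightarrow> 'a \<Rightarrow> complex) \<Rightarrow> bool" where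
  "continuous_bilinear \<phi> \<longleftrightarrow>
     (\<forall>a. clinear (\<lambda>b. \<phi> a b)) \<and> (\<forall>b. clinear (\<lambda>a. \<phi> a b)) \<and>
     continuous_on UNIV (\<lambda>(a, b). \<phi> a b)"

definition property_B :: "'a::complex_banach_algebra itself \<Rightarrow> bool" where
  "property_B _ \<longleftrightarrow>
     (\<forall>\<phi> :: 'a \<Rightarrow> 'a \<Rightarrow> complex.
        continuous_bilinear \<phi> \<and> (\<forall>a b. a * b = 0 \<longrightarrow> \<phi> a b = 0) \<longrightarrow>
        (\<forall>a b c. \<phi> (a * b) c = \<phi> a (b * c)))"


section \<open>Bounded approximate identities\<close>

text \<open>
  Nets are families convergent along a proper filter on the index type: a net over a directed
  set is the case in which \<open>F\<close> is generated by the tails of that set.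
\<close>

definition bounded_approximate_identity ::
    "('i \<Rightarrow> 'a::complex_normed_algebra) \<Rightarrow> 'i filter \<Rightarrow> bool" where
  "bounded_approximate_identity e F \<longleftrightarrow>
     F \<noteq> bot \<and> bounded (range e) \<and>
     (\<forall>a. ((\<lambda>i. e i * a) \<longlongrightarrow> a) F) \<and> (\<forall>a. ((\<lambda>i. a * e i) \<longlongrightarrow> a) F)"

end

theory Submission
  imports Defs
begin

text \<open>
  For fixed \<open>c\<close>, \<open>d\<close> with \<open>c d = 0\<close>, the elements \<open>d a\<close> and \<open>b c\<close> annihilate each other on both sides
  as soon as \<open>a b = 0\<close>. So \<open>(a, b) \<mapsto> \<phi> (d a) (b c)\<close> vanishes on zero products and property B
  applies to it. The resulting identity says that another bilinear functional, now of \<open>(c, d)\<close>,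
  vanishes on zero products, and property B applies a second time. Letting the superfluous factors
  run through the approximate identity \<open>e\<close> yields \<open>two_sided_balance\<close>:
  \<open>\<phi> (a x) (b y) - \<phi> a (x b y) = \<phi> (y a x) b - \<phi> (y a) (x b)\<close>.

  Now let \<open>a\<close> run through \<open>e\<close>. Every term but \<open>\<phi> (e\<^sub>i) (x b y)\<close> visibly
  converges, hence so does this one. Products of three factors are dense and the functionals
  \<open>\<phi> (e\<^sub>i)\<close> are uniformly bounded, so \<open>\<sigma>(z) = lim \<phi> (e\<^sub>i) z\<close> exists for every \<open>z\<close> and is a continuous
  functional, with \<open>\<phi> (y x) b = \<phi> y (x b) + \<phi> x (b y) - \<sigma> (x b y)\<close>.
  This is the derivation law for \<open>y \<mapsto> \<phi> y\<close> up to the \<open>\<sigma>\<close>-term, and subtracting \<open>\<sigma> (x b)\<close>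
  from \<open>\<phi> x b\<close> absorbs that term. Weak amenability then provides \<open>\<omega>\<close> with
  \<open>\<phi> x b - \<sigma> (x b) = \<omega> (b x) - \<omega> (x b)\<close>, so that \<open>\<tau>\<^sub>1 = \<sigma> - \<omega>\<close> and \<open>\<tau>\<^sub>2 = \<omega>\<close> represent \<open>\<phi>\<close>.
\<close>

section \<open>Bounded bilinear maps\<close>

lemma clinear_scaleR:
  fixes f :: "'a::complex_normed_vector \<Rightarrow> 'b::complex_normed_vector"
  assumes "clinear f"
  shows "f (r *\<^sub>R x) = r *\<^sub>R f x"
  using assms by (simp add: clinear_def scaleR_conv_scaleC)

lemma continuous_bilinear_imp_bounded_bilinear:
  fixes \<phi> :: "'a::complex_normed_vector \<Rightarrow> 'a \<Rightarrow> complex"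
  assumes "continuous_bilinear \<phi>"
  shows "bounded_bilinear \<phi>"
proof -
  have lr: "clinear (\<phi> a)" and ll: "clinear (\<lambda>a. \<phi> a b)" for a b
    using assms by (auto simp: continuous_bilinear_def)
  have cont: "continuous_on UNIV (\<lambda>p. \<phi> (fst p) (snd p))"
    using assms by (auto simp: continuous_bilinear_def case_prod_unfold)
  have sr: "\<phi> a (r *\<^sub>R b) = r *\<^sub>R \<phi> a b" and sl: "\<phi> (r *\<^sub>R a) b = r *\<^sub>R \<phi> a b" for a b r
    using clinear_scaleR[OF lr] clinear_scaleR[OF ll] by auto
  have zl: "\<phi> 0 b = 0" and zr: "\<phi> a 0 = 0" for a b
    using sl[of 0 0] sr[of _ 0 0] by auto
  have "isCont (\<lambda>p. \<phi> (fst p) (snd p)) (0, 0)"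
    using cont by (simp add: continuous_on_eq_continuous_at)
  then obtain \<delta> where \<delta>: "\<delta> > 0"
      "\<And>p. dist p (0, 0) < \<delta> \<Longrightarrow> dist (\<phi> (fst p) (snd p)) (\<phi> 0 0) < 1"
    unfolding continuous_at_eps_delta by (metis fst_conv snd_conv zero_less_one)
  define t where "t = \<delta> / 3"
  have t: "t > 0" using \<delta> by (simp add: t_def)
  have unit: "norm (\<phi> a b) \<le> 1 / t\<^sup>2" if "norm a = 1" "norm b = 1" for a b
  proof -
    have "norm (t *\<^sub>R a, t *\<^sub>R b) \<le> norm (t *\<^sub>R a) + norm (t *\<^sub>R b)"
      by (rule norm_Pair_le)
    also have "\<dots> < \<delta>" using that \<delta>(1) by (simp add: t_def)
    finally have "norm (\<phi> (t *\<^sub>R a) (t *\<^sub>R b)) < 1"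
      using \<delta>(2)[of "(t *\<^sub>R a, t *\<^sub>R b)"] by (simp add: zl dist_norm)
    then have "t\<^sup>2 * norm (\<phi> a b) < 1"
      using t by (simp add: sl sr power2_eq_square mult.assoc)
    then show ?thesis using t by (simp add: field_simps)
  qed
  have bound: "norm (\<phi> a b) \<le> norm a * norm b * (1 / t\<^sup>2)" for a b
  proof (cases "a = 0 \<or> b = 0")
    case True
    then show ?thesis by (auto simp: zl zr)
  next
    case False
    have "\<phi> a b = \<phi> (norm a *\<^sub>R sgn a) (norm b *\<^sub>R sgn b)"
      using False by (simp add: sgn_div_norm)
    also have "\<dots> = norm b *\<^sub>R norm a *\<^sub>R \<phi> (sgn a) (sgn b)"
      by (simp only: sl sr)
    finally have "norm (\<phi> a b) = norm a * norm b * norm (\<phi> (sgn a) (sgn b))"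
      by simp
    also have "\<dots> \<le> norm a * norm b * (1 / t\<^sup>2)"
      using False by (intro mult_left_mono unit) (auto simp: norm_sgn)
    finally show ?thesis .
  qed
  show ?thesis
    using lr ll bound by (intro bounded_bilinear.intro exI[of _ "1 / t\<^sup>2"])
      (auto simp: clinear_def sl sr)
qed

lemma bounded_bilinear_imp_bounded_linear_Blinfun:
  assumes "bounded_bilinear \<beta>"
  shows "bounded_linear (\<lambda>a. Blinfun (\<beta> a))"
proof -
  interpret bounded_bilinear \<beta> by fact
  obtain K where K: "K \<ge> 0" "\<And>a b. norm (\<beta> a b) \<le> norm a * norm b * K"
    using nonneg_bounded by blast
  show ?thesis
  proof (rule bounded_linear_intro[where K = K])
    show "norm (Blinfun (\<beta> a)) \<le> norm a * K" for a
      using K by (intro norm_blinfun_bound)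
        (auto simp: bounded_linear_Blinfun_apply bounded_linear_right mult_ac)
  qed (auto intro!: blinfun_eqI simp: bounded_linear_Blinfun_apply bounded_linear_right
      add_left scaleR_left blinfun.add_left blinfun.scaleR_left)
qed

section \<open>Pointwise limits of equicontinuous families\<close>

text \<open>
  Equicontinuity makes \<open>T i z\<close> uniformly close to \<open>T i w\<close> when \<open>w\<close> is close to \<open>z\<close>, so the net at \<open>z\<close>
  inherits the Cauchy property from the net at \<open>w\<close>.
\<close>

lemma closed_convergence_set:
  fixes T :: "'i \<Rightarrow> 'a::real_normed_vector \<Rightarrow> 'b::banach"
  assumes lin: "\<And>i. bounded_linear (T i)"
    and bound: "\<And>i z. norm (T i z) \<le> norm z * K"
    and F: "F \<noteq> bot"
  shows "closed {z. \<exists>l. ((\<lambda>i. T i z) \<longlongrightarrow> l) F}" (is "closed ?S")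
proof -
  have "z \<in> ?S" if z: "z \<in> closure ?S" for z
  proof -
    have "cauchy_filter (filtermap (\<lambda>i. T i z) F)"
      unfolding cauchy_filter_metric_filtermap
    proof (intro allI impI)
      fix \<epsilon> :: real assume \<epsilon>: "\<epsilon> > 0"
      \<comment> \<open>The summand \<open>1\<close> avoids a division by zero for \<open>K = 0\<close>.\<close>
      define \<delta> where "\<delta> = \<epsilon> / 4 / (\<bar>K\<bar> + 1)"
      have \<delta>: "\<delta> > 0" using \<epsilon> by (simp add: \<delta>_def add_nonneg_pos)
      obtain w l where w: "dist w z < \<delta>" and l: "((\<lambda>i. T i w) \<longlongrightarrow> l) F"
        using z \<delta> unfolding closure_approachable by blast
      have close: "dist (T i z) (T i w) < \<epsilon> / 4" for i
      proof -
        have "dist (T i z) (T i w) = norm (T i (z - w))"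
          by (simp add: dist_norm linear_diff[OF bounded_linear.linear[OF lin]])
        also have "\<dots> \<le> norm (z - w) * (\<bar>K\<bar> + 1)"
          by (rule order_trans[OF bound mult_left_mono]) auto
        also have "\<dots> < \<delta> * (\<bar>K\<bar> + 1)"
          using w by (intro mult_strict_right_mono) (auto simp: dist_norm norm_minus_commute)
        also have "\<delta> * (\<bar>K\<bar> + 1) = \<epsilon> / 4"
          using abs_ge_zero[of K] by (simp add: \<delta>_def divide_simps)
        finally show ?thesis .
      qed
      have "\<forall>\<^sub>F i in F. dist (T i w) l < \<epsilon> / 4"
        using l \<epsilon> by (intro tendstoD) auto
      moreover have "dist (T i z) (T j z) < \<epsilon>"
        if "dist (T i w) l < \<epsilon> / 4" "dist (T j w) l < \<epsilon> / 4" for i j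
      proof -
        have "dist (T i z) (T j z) \<le> dist (T i z) (T i w) + (dist (T i w) l + dist (T j w) l)
            + dist (T j z) (T j w)"
          by metric
        then show ?thesis using close[of i] close[of j] that by linarith
      qed
      ultimately show "\<exists>P. eventually P F \<and> (\<forall>i j. P i \<and> P j \<longrightarrow> dist (T i z) (T j z) < \<epsilon>)"
        by blast
    qed
    then obtain l where "filtermap (\<lambda>i. T i z) F \<le> nhds l"
      using cauchy_filter_complete_converges[OF _ complete_UNIV, of "filtermap (\<lambda>i. T i z) F"] F
      by (auto simp: filtermap_bot_iff)
    then show ?thesis
      by (auto simp: filterlim_def)
  qed
  then have "closure ?S \<subseteq> ?S" by (rule subsetI)
  then show ?thesis by (simp only: closure_subset_eq)
qed

lemma pointwise_limit_in_dual:
  fixes T :: "'i \<Rightarrow> 'a::complex_normed_vector \<Rightarrow> complex"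
  assumes lin: "\<And>i. clinear (T i)"
    and bound: "\<And>i z. norm (T i z) \<le> norm z * K"
    and conv: "\<And>z. \<exists>l. ((\<lambda>i. T i z) \<longlongrightarrow> l) F"
    and F: "F \<noteq> bot"
  obtains \<sigma> where "\<sigma> \<in> dual" "\<And>z. ((\<lambda>i. T i z) \<longlongrightarrow> blinfun_apply \<sigma> z) F"
proof -
  obtain s where s: "\<And>z. ((\<lambda>i. T i z) \<longlongrightarrow> s z) F" using conv by metis
  have "s (x + y) = s x + s y" for x y
    using tendsto_unique[OF F s[of "x + y"]] tendsto_add[OF s[of x] s[of y]] lin
    by (simp add: clinear_def)
  moreover have "s (c *\<^sub>C x) = c *\<^sub>C s x" for c x
    using tendsto_unique[OF F s[of "c *\<^sub>C x"]] tendsto_mult_left[OF s[of x], of c] lin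
    by (simp add: clinear_def scaleC_complex_def)
  ultimately have cl: "clinear s" by (simp add: clinear_def)
  have "norm (s z) \<le> norm z * K" for z
    by (rule tendsto_upperbound[OF tendsto_norm[OF s] _ F]) (simp add: bound)
  then have bl: "bounded_linear s"
    using cl by (intro bounded_linear_intro[where K = K])
      (simp_all add: clinear_scaleR, simp add: clinear_def)
  show thesis
    using cl bl s by (intro that[of "Blinfun s"])
      (simp_all add: dual_def bounded_linear_Blinfun_apply)
qed

section \<open>Two applications of property B\<close>

lemma property_B_D:
  fixes \<phi> :: "'a::complex_banach_algebra \<Rightarrow> 'a \<Rightarrow> complex"
  assumes "property_B TYPE('a)" "continuous_bilinear \<phi>" "\<And>a b. a * b = 0 \<Longrightarrow> \<phi> a b = 0"
  shows "\<phi> (a * b) c = \<phi> a (b * c)"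
  using assms unfolding property_B_def by blast

lemma continuous_bilinear_mult:
  fixes \<phi> :: "'a::complex_normed_algebra \<Rightarrow> 'a \<Rightarrow> complex"
  assumes "continuous_bilinear \<phi>"
  shows "continuous_bilinear (\<lambda>a b. \<phi> (d * a) (b * c))"
    and "continuous_bilinear (\<lambda>c d. \<phi> (d * u) (v * c))"
proof -
  note cont = bounded_bilinear.continuous_on[OF continuous_bilinear_imp_bounded_bilinear[OF assms]]
  have "continuous_on UNIV (\<lambda>p. \<phi> (d * fst p) (snd p * c))"
    "continuous_on UNIV (\<lambda>p. \<phi> (snd p * u) (v * fst p))"
    by (intro cont continuous_intros)+
  then show "continuous_bilinear (\<lambda>a b. \<phi> (d * a) (b * c))"
    and "continuous_bilinear (\<lambda>c d. \<phi> (d * u) (v * c))"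
    using assms
    by (simp_all add: continuous_bilinear_def clinear_def case_prod_unfold distrib_left
        distrib_right mult_scaleC_left mult_scaleC_right)
qed

lemma continuous_bilinear_diff:
  assumes "continuous_bilinear \<phi>" "continuous_bilinear \<psi>"
  shows "continuous_bilinear (\<lambda>a b. \<phi> a b - \<psi> a b)"
  using assms
  by (auto simp: continuous_bilinear_def clinear_def case_prod_unfold scaleC_complex_def
      algebra_simps intro!: continuous_intros)

text \<open>
  In the proof, \<open>first\<close> comes from property B in the variables \<open>(a, b)\<close>, and \<open>second\<close> from property B
  in \<open>(c, d)\<close>; setting \<open>c = d = e i\<close> in \<open>second\<close> and passing to the limit removes these two.
\<close>

lemma two_sided_balance:
  fixes \<phi> :: "'a::complex_banach_algebra \<Rightarrow> 'a \<Rightarrow> complex"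
    and e :: "'i \<Rightarrow> 'a"
  assumes B: "property_B TYPE('a)"
    and bai: "bounded_approximate_identity e F"
    and \<phi>: "continuous_bilinear \<phi>"
    and zero: "\<And>a b. a * b = 0 \<Longrightarrow> b * a = 0 \<Longrightarrow> \<phi> a b = 0"
  shows "\<phi> (a * x) (b * y) - \<phi> a (x * b * y) = \<phi> (y * a * x) b - \<phi> (y * a) (x * b)"
proof -
  interpret bounded_bilinear \<phi>
    using \<phi> by (rule continuous_bilinear_imp_bounded_bilinear)
  have first: "\<phi> (d * (a * x)) (b * c) = \<phi> (d * a) (x * b * c)" if "c * d = 0" for c d
  proof (rule property_B_D[OF B continuous_bilinear_mult(1)[OF \<phi>]])
    fix a b :: 'a assume "a * b = 0"
    have "d * a * (b * c) = d * (a * b) * c" "b * c * (d * a) = b * (c * d) * a"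
      by (simp_all add: mult.assoc)
    then show "\<phi> (d * a) (b * c) = 0"
      using \<open>a * b = 0\<close> \<open>c * d = 0\<close> by (intro zero) simp_all
  qed
  have second: "\<phi> (d * (a * x)) (b * (c * y)) - \<phi> (d * a) (x * b * (c * y))
      = \<phi> (y * d * (a * x)) (b * c) - \<phi> (y * d * a) (x * b * c)" for c d
    by (rule property_B_D[OF B continuous_bilinear_diff[OF continuous_bilinear_mult(2)[OF \<phi>]
            continuous_bilinear_mult(2)[OF \<phi>]]]) (simp add: first)
  have F: "F \<noteq> bot" and el: "((\<lambda>i. e i * z) \<longlongrightarrow> z) F" and er: "((\<lambda>i. z * e i) \<longlongrightarrow> z) F" for z
    using bai by (auto simp: bounded_approximate_identity_def)
  have "((\<lambda>i. \<phi> (e i * (a * x)) (b * (e i * y)) - \<phi> (e i * a) (x * b * (e i * y)))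
      \<longlongrightarrow> \<phi> (a * x) (b * y) - \<phi> a (x * b * y)) F"
    by (intro tendsto_intros tendsto el)
  moreover have "((\<lambda>i. \<phi> (y * e i * (a * x)) (b * e i) - \<phi> (y * e i * a) (x * b * e i))
      \<longlongrightarrow> \<phi> (y * (a * x)) b - \<phi> (y * a) (x * b)) F"
    by (intro tendsto_intros tendsto er)
  ultimately show ?thesis
    unfolding second using tendsto_unique[OF F] by (simp add: mult.assoc)
qed

section \<open>The correcting functional\<close>

text \<open>
  Equivalently, \<open>(x, b) \<mapsto> \<phi> x b - \<sigma> (x b)\<close> induces a derivation into the dual. The functional
  \<open>\<sigma>\<close> takes the place of \<open>\<phi> 1\<close>, which it is when the algebra has a unit.
\<close>

lemma ex_correcting_functional:
  fixes \<phi> :: "'a::complex_banach_algebra \<Rightarrow> 'a \<Rightarrow> complex"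
    and e :: "'i \<Rightarrow> 'a"
  assumes bai: "bounded_approximate_identity e F"
    and \<phi>: "continuous_bilinear \<phi>"
    and balance: "\<And>a b x y.
      \<phi> (a * x) (b * y) - \<phi> a (x * b * y) = \<phi> (y * a * x) b - \<phi> (y * a) (x * b)"
  obtains \<sigma> where "\<sigma> \<in> dual"
    "\<And>x y b. \<phi> (y * x) b = \<phi> y (x * b) + \<phi> x (b * y) - blinfun_apply \<sigma> (x * b * y)"
proof -
  interpret bounded_bilinear \<phi>
    using \<phi> by (rule continuous_bilinear_imp_bounded_bilinear)
  have F: "F \<noteq> bot" and el: "((\<lambda>i. e i * z) \<longlongrightarrow> z) F" and er: "((\<lambda>i. z * e i) \<longlongrightarrow> z) F" for z
    using bai by (auto simp: bounded_approximate_identity_def)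
  have lim: "((\<lambda>i. \<phi> (e i) (x * b * y)) \<longlongrightarrow> \<phi> x (b * y) - \<phi> (y * x) b + \<phi> y (x * b)) F"
    for x b y
  proof -
    have eq: "\<phi> (e i) (x * b * y)
        = \<phi> (e i * x) (b * y) - \<phi> (y * (e i * x)) b + \<phi> (y * e i) (x * b)" for i
      using balance[of "e i" x b y] by (simp add: algebra_simps)
    show ?thesis
      unfolding eq by (intro tendsto_intros tendsto el er)
  qed
  obtain M where M: "\<And>i. norm (e i) \<le> M"
    using bai by (auto simp: bounded_approximate_identity_def bounded_iff)
  obtain L where L: "L \<ge> 0" "\<And>a b. norm (\<phi> a b) \<le> norm a * norm b * L"
    using nonneg_bounded by blast
  have bound: "norm (\<phi> (e i) z) \<le> norm z * (M * L)" for i z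
  proof -
    have "norm (e i) * (norm z * L) \<le> M * (norm z * L)"
      using L(1) by (intro mult_right_mono M) simp
    then show ?thesis using L(2)[of "e i" z] by (simp add: mult_ac)
  qed
  let ?S = "{z. \<exists>l. ((\<lambda>i. \<phi> (e i) z) \<longlongrightarrow> l) F}"
  have closed: "closed ?S"
    using bounded_linear_right bound F by (rule closed_convergence_set)
  \<comment> \<open>Triple products lie in \<open>?S\<close>; one factor at a time is removed along the approximate identity.\<close>
  have "x * b * y \<in> ?S" for x b y
    using lim by blast
  then have "x * b \<in> ?S" for x b
    by (rule Lim_in_closed_set[OF closed always_eventually F er, OF allI])
  then have "z \<in> ?S" for z
    by (rule Lim_in_closed_set[OF closed always_eventually F er, OF allI])
  then have conv: "\<exists>l. ((\<lambda>i. \<phi> (e i) z) \<longlongrightarrow> l) F" for z by blast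
  have "clinear (\<phi> a)" for a
    using \<phi> by (simp add: continuous_bilinear_def)
  from this bound conv F obtain \<sigma> where \<sigma>: "\<sigma> \<in> dual"
      "\<And>z. ((\<lambda>i. \<phi> (e i) z) \<longlongrightarrow> blinfun_apply \<sigma> z) F"
    by (rule pointwise_limit_in_dual) blast
  have "blinfun_apply \<sigma> (x * b * y) = \<phi> x (b * y) - \<phi> (y * x) b + \<phi> y (x * b)" for x b y
    using tendsto_unique[OF F \<sigma>(2) lim] .
  then have "\<phi> (y * x) b = \<phi> y (x * b) + \<phi> x (b * y) - blinfun_apply \<sigma> (x * b * y)" for x y b
    by (simp only:) simp
  then show thesis
    using \<sigma>(1) by (intro that) auto
qed

section \<open>Representation of the bilinear functional\<close>

theorem theorem2p7:
  fixes \<phi> :: "'a::complex_banach_algebra \<Rightarrow> 'a \<Rightarrow> complex"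
    and e :: "'i \<Rightarrow> 'a" and F :: "'i filter"
  assumes "weakly_amenable TYPE('a)"
    and "property_B TYPE('a)"
    and "bounded_approximate_identity e F"
    and "continuous_bilinear \<phi>"
    and "\<And>a b. a * b = 0 \<Longrightarrow> b * a = 0 \<Longrightarrow> \<phi> a b = 0"
  shows "\<exists>\<tau>\<^sub>1\<in>dual. \<exists>\<tau>\<^sub>2\<in>dual. \<forall>a b. \<phi> a b = blinfun_apply \<tau>\<^sub>1 (a * b) + blinfun_apply \<tau>\<^sub>2 (b * a)"
proof -
  obtain \<sigma> where \<sigma>: "\<sigma> \<in> dual"
    "\<And>x y b. \<phi> (y * x) b = \<phi> y (x * b) + \<phi> x (b * y) - blinfun_apply \<sigma> (x * b * y)"
    using ex_correcting_functional[OF assms(3,4) two_sided_balance[OF assms(2-5)]] by blast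
  let ?\<beta> = "\<lambda>a b. \<phi> a b - blinfun_apply \<sigma> (a * b)"
  define D where "D a = Blinfun (?\<beta> a)" for a
  have "continuous_bilinear (\<lambda>a b. blinfun_apply \<sigma> (a * b))"
    using \<sigma>(1) by (auto simp: continuous_bilinear_def clinear_def dual_def case_prod_unfold
        distrib_left distrib_right mult_scaleC_left mult_scaleC_right intro!: continuous_intros)
  with assms(4) have \<beta>: "continuous_bilinear ?\<beta>"
    by (rule continuous_bilinear_diff)
  then have bb: "bounded_bilinear ?\<beta>"
    by (rule continuous_bilinear_imp_bounded_bilinear)
  have D_apply: "blinfun_apply (D a) b = ?\<beta> a b" for a b
    unfolding D_def using bounded_bilinear.bounded_linear_right[OF bb]
    by (simp add: bounded_linear_Blinfun_apply)
  have "D a \<in> dual" for a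
    using \<beta> by (simp add: dual_def D_apply[abs_def] continuous_bilinear_def)
  moreover have "clinear D"
    using \<beta> by (auto simp: clinear_def continuous_bilinear_def D_apply blinfun.add_left
        scaleC_blinfun.rep_eq intro!: blinfun_eqI)
  moreover have "D (a * b) = act_right (D a) b + act_left a (D b)" for a b
    by (rule blinfun_eqI) (simp add: D_apply blinfun.add_left \<sigma>(2) mult.assoc)
  ultimately have "derivation D" by (simp add: derivation_def)
  moreover have "continuous_on UNIV D"
    unfolding D_def
    by (intro linear_continuous_on bounded_bilinear_imp_bounded_linear_Blinfun bb)
  ultimately have "inner_derivation D"
    using assms(1) by (simp add: weakly_amenable_def)
  then obtain \<omega> where \<omega>: "\<omega> \<in> dual" "\<And>a. D a = act_left a \<omega> - act_right \<omega> a"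
    by (auto simp: inner_derivation_def)
  have "\<phi> a b = blinfun_apply (\<sigma> - \<omega>) (a * b) + blinfun_apply \<omega> (b * a)" for a b
    using D_apply[of a b] by (simp add: \<omega>(2) blinfun.diff_left algebra_simps)
  moreover have "\<sigma> - \<omega> \<in> dual"
    using \<sigma>(1) \<omega>(1)
    by (simp add: dual_def clinear_def blinfun.diff_left scaleC_complex_def algebra_simps)
  ultimately show ?thesis using \<omega>(1) by blast
qed

end
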